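(* For every proper subclass $\mathcal M$ of $\mathcal E_3$ that is closed under induced restrictions, there exists $k$ such that $\chi(M)\le k$ for all $M\in\mathcal M$.
   Context: A simple binary matroid (here just "matroid") is a pair $M=(E,G)$, where $G$ is identified with $\mathbb F_2^n\setminus\{0\}$ for some $n\ge0$ and $E\subseteq G$; $\dim(M)=n$. A flat of $G$ is a set $V\setminus\{0\}$ with $V$ a subspace of $\mathbb F_2^n$, of dimension $\dim V$. $N$ is an induced restriction of $M$ if there is an injective linear map $\varphi:G(N)\to G$ (linear on the underlying vector spaces) with $\varphi(E(N))=E\cap\varphi(G(N))$; matroids are considered up to isomorphism (bijective such $\varphi$). The critical number $\chi(M)$ is the smallest $k\ge0$ such that $G\setminus E$ contains a flat of dimension $n-k$. $\mathcal E_3$ is the class of matroids $M=(E,G)$ with $|E\cap F|$ even for every flat $F$ of $G$ of dimension at least $3$. *)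

theory Defs
  imports Complex_Main "HOL-Library.Z2" "HOL-Library.Function_Algebras"
begin

text \<open>
  The dimension of a matroid varies inside the statement, so the space of dimension \<open>n\<close> over the
  two-element field is realised as the set of functions \<^typ>\<open>nat \<Rightarrow> bit\<close> that vanish from
  position \<open>n\<close> on, inside the vector space of all such functions.
\<close>

definition smul :: "bit \<Rightarrow> (nat \<Rightarrow> bit) \<Rightarrow> (nat \<Rightarrow> bit)" where
  "smul c v = (\<lambda>i. c * v i)"

global_interpretation F2: vector_space smul
  by unfold_locales (auto simp: smul_def fun_eq_iff algebra_simps)

definition coord_space :: "nat \<Rightarrow> (nat \<Rightarrow> bit) set" where
  "coord_space n = {v. \<forall>i\<ge>n. v i = 0}"

text \<open>A pair \<open>(E, G)\<close> is encoded by the dimension of \<open>G\<close> and the set \<open>E\<close>.\<close>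

record matroid =
  dimension :: nat
  elements :: "(nat \<Rightarrow> bit) set"

definition ground :: "matroid \<Rightarrow> (nat \<Rightarrow> bit) set" where
  "ground M = coord_space (dimension M) - {0}"

definition simple_binary_matroid :: "matroid \<Rightarrow> bool" where
  "simple_binary_matroid M \<longleftrightarrow> elements M \<subseteq> ground M"

definition is_flat :: "matroid \<Rightarrow> nat \<Rightarrow> (nat \<Rightarrow> bit) set \<Rightarrow> bool" where
  "is_flat M d F \<longleftrightarrow>
     (\<exists>V. F2.subspace V \<and> V \<subseteq> coord_space (dimension M) \<and> F2.dim V = d \<and> F = V - {0})"

definition linear_between :: "nat \<Rightarrow> nat \<Rightarrow> ((nat \<Rightarrow> bit) \<Rightarrow> (nat \<Rightarrow> bit)) \<Rightarrow> bool" where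
  "linear_between m n \<phi> \<longleftrightarrow>
     \<phi> ` coord_space m \<subseteq> coord_space n \<and>
     (\<forall>u\<in>coord_space m. \<forall>v\<in>coord_space m. \<phi> (u + v) = \<phi> u + \<phi> v) \<and>
     (\<forall>c. \<forall>v\<in>coord_space m. \<phi> (smul c v) = smul c (\<phi> v))"

definition induced_restriction :: "matroid \<Rightarrow> matroid \<Rightarrow> bool" where
  "induced_restriction N M \<longleftrightarrow>
     (\<exists>\<phi>. linear_between (dimension N) (dimension M) \<phi> \<and> inj_on \<phi> (coord_space (dimension N)) \<and>
          \<phi> ` elements N = elements M \<inter> \<phi> ` ground N)"

text \<open>
  Isomorphic matroids are induced restrictions of one another, so a class closed in this sense is
  in particular closed under isomorphism.
\<close>

definition closed_under_induced_restrictions :: "matroid set \<Rightarrow> bool" where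
  "closed_under_induced_restrictions \<M> \<longleftrightarrow>
     (\<forall>M\<in>\<M>. \<forall>N. simple_binary_matroid N \<and> induced_restriction N M \<longrightarrow> N \<in> \<M>)"

text \<open>
  The set of admissible \<open>k\<close> contains \<open>dimension M\<close>, because the empty set is a flat of dimension 0.
\<close>

definition critical_number :: "matroid \<Rightarrow> nat" where
  "critical_number M =
     (LEAST k. k \<le> dimension M \<and>
        (\<exists>F. is_flat M (dimension M - k) F \<and> F \<subseteq> ground M - elements M))"

definition \<E>\<^sub>3 :: "matroid set" where
  "\<E>\<^sub>3 = {M. simple_binary_matroid M \<and>
     (\<forall>d F. 3 \<le> d \<and> is_flat M d F \<longrightarrow> even (card (elements M \<inter> F)))}"

end

theory Submission
  imports Defs
begin

text \<open>
  For \<open>M\<close> in \<open>\<E>\<^sub>3\<close> the characteristic function \<open>f\<close> of the elements is quadratic: three-dimensional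
  flats say exactly that its polar form \<open>B(x, y) = f(x + y) + f(x) + f(y)\<close> is bilinear. If a space
  \<open>V\<close> contains no hyperbolic pair (\<open>f(e) = f(h) = 0\<close>, \<open>B(e, h) = 1\<close>), the zeros of \<open>f\<close> on \<open>V\<close> form a
  subspace of codimension at most 2. Otherwise \<open>V\<close> is the sum of a hyperbolic plane and its orthogonal
  complement, and each hyperbolic plane split off allows one more dimension of an arbitrary quadratic
  function to be embedded. So either a matroid \<open>N\<close> of \<open>\<E>\<^sub>3\<close> is an induced restriction of \<open>M\<close>, or the
  critical number of \<open>M\<close> is at most \<open>2 dim N\<close>.
\<close>

text \<open>
  The default simp rules turn sums and products of bits into bitwise operators, which blocks the
  arithmetic simplification rules.
\<close>

declare add_bit_eq_xor [simp del] mult_bit_eq_and [simp del]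

section \<open>Arithmetic in characteristic two\<close>

lemma bit_add_self [simp]: "b + b = (0 :: bit)"
  by (cases b) simp_all

lemma bit_add_self_left [simp]: "b + (b + c) = (c :: bit)"
  by (simp flip: add.assoc)

lemma vec_add_self [simp]: "v + v = (0 :: nat \<Rightarrow> bit)"
  by (simp add: fun_eq_iff)

lemma vec_add_self_left [simp]: "v + (v + w) = (w :: nat \<Rightarrow> bit)"
  by (simp flip: add.assoc)

lemma vec_minus [simp]: "v - w = (v + w :: nat \<Rightarrow> bit)"
  by (simp add: fun_eq_iff)

lemma vec_add_eq_0_iff [simp]: "v + w = 0 \<longleftrightarrow> v = (w :: nat \<Rightarrow> bit)"
  by (metis vec_add_self vec_add_self_left add.right_neutral)

lemma all_bit_iff: "(\<forall>c::bit. P c) \<longleftrightarrow> P 0 \<and> P 1"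
  by (metis bit.exhaust)

lemma subspace_iff:
  "F2.subspace V \<longleftrightarrow> 0 \<in> V \<and> (\<forall>x\<in>V. \<forall>y\<in>V. x + y \<in> V)"
  by (auto simp: F2.subspace_def all_bit_iff)

text \<open>The only scalars are 0 and 1, so the coefficient of \<open>a\<close> leaves just two
  cases.\<close>

lemma span_insert_iff: "x \<in> F2.span (insert a S) \<longleftrightarrow> x \<in> F2.span S \<or> x + a \<in> F2.span S"
proof -
  have "x \<in> F2.span (insert a S) \<longleftrightarrow> (\<exists>k. x - smul k a \<in> F2.span S)"
    by (auto simp only: F2.span_insert mem_Collect_eq)
  then show ?thesis
    by (metis (full_types) bit.exhaust F2.scale_zero_left F2.scale_one vec_minus add.right_neutral)
qed

section \<open>Coordinate spaces and their standard bases\<close>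

lemma subspace_coord_space: "F2.subspace (coord_space n)"
  by (auto simp: subspace_iff coord_space_def)

definition unit_vector :: "nat \<Rightarrow> nat \<Rightarrow> bit" where
  "unit_vector i = (\<lambda>j. of_bool (i = j))"

lemma coord_space_0: "coord_space 0 = {0}"
  by (auto simp: coord_space_def fun_eq_iff)

lemma coord_space_mono: "m \<le> n \<Longrightarrow> coord_space m \<subseteq> coord_space n"
  by (auto simp: coord_space_def)

lemma unit_vector_in: "unit_vector n \<in> coord_space (Suc n)"
  by (auto simp: coord_space_def unit_vector_def)

lemma coord_space_Suc_cases:
  assumes "x \<in> coord_space (Suc n)"
  shows "x \<in> coord_space n \<and> x n = 0 \<or> x + unit_vector n \<in> coord_space n \<and> x n = 1"
  using assms
  by (cases "x n") (simp_all add: coord_space_def unit_vector_def le_Suc_eq nat_less_le Suc_le_eq, metis+)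

text \<open>Bundled for the induction: the earlier unit vectors span \<open>coord_space n\<close>,
  which misses \<open>unit_vector n\<close>; this gives both independence and the new
  cardinality.\<close>

lemma coord_space_basis:
  "finite (unit_vector ` {..<n}) \<and> F2.span (unit_vector ` {..<n}) = coord_space n \<and>
   F2.independent (unit_vector ` {..<n}) \<and> card (unit_vector ` {..<n}) = n"
proof (induction n)
  case 0
  then show ?case by (simp add: coord_space_0 F2.independent_empty)
next
  case (Suc n)
  let ?u = "unit_vector n"
  have "?u \<notin> coord_space n"
    by (auto simp: coord_space_def unit_vector_def)
  moreover from this have "?u \<notin> unit_vector ` {..<n}"
    using Suc F2.span_base[of ?u "unit_vector ` {..<n}"] by metis
  moreover have "x \<in> coord_space (Suc n) \<longleftrightarrow> x \<in> coord_space n \<or> x + ?u \<in> coord_space n" for x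
  proof
    assume "x \<in> coord_space n \<or> x + ?u \<in> coord_space n"
    then have "x \<in> coord_space (Suc n) \<or> x + ?u \<in> coord_space (Suc n)"
      using coord_space_mono[of n "Suc n"] by auto
    moreover have "x = (x + ?u) + ?u"
      by (simp add: add.assoc)
    ultimately show "x \<in> coord_space (Suc n)"
      using F2.subspace_add[OF subspace_coord_space _ unit_vector_in] by metis
  qed (use coord_space_Suc_cases in blast)
  ultimately show ?case
    using Suc by (auto simp: lessThan_Suc span_insert_iff F2.independent_insertI)
qed

section \<open>Codimension of subspaces\<close>

text \<open>
  Stated by a spanning set because the ambient space of all functions is infinite-dimensional,
  where few facts about \<^const>\<open>F2.dim\<close> are available.
\<close>

definition codim_le :: "(nat \<Rightarrow> bit) set \<Rightarrow> (nat \<Rightarrow> bit) set \<Rightarrow> nat \<Rightarrow> bool" where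
  "codim_le Z V k \<longleftrightarrow> (\<exists>S. finite S \<and> card S \<le> k \<and> V \<subseteq> F2.span (Z \<union> S))"

lemma codim_le_mono: "codim_le Z V k \<Longrightarrow> k \<le> l \<Longrightarrow> codim_le Z V l"
  unfolding codim_le_def by (meson order_trans)

lemma codim_le_trans:
  assumes "codim_le Z W k" "codim_le W V l"
  shows "codim_le Z V (k + l)"
proof -
  obtain S T where S: "finite S" "card S \<le> k" "W \<subseteq> F2.span (Z \<union> S)"
    and T: "finite T" "card T \<le> l" "V \<subseteq> F2.span (W \<union> T)"
    using assms unfolding codim_le_def by blast
  have "W \<union> T \<subseteq> F2.span (Z \<union> (S \<union> T))"
    using S(3) F2.span_mono[of "Z \<union> S" "Z \<union> (S \<union> T)"] F2.span_superset[of "Z \<union> (S \<union> T)"]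
    by blast
  then have "V \<subseteq> F2.span (Z \<union> (S \<union> T))"
    using T(3) F2.span_mono F2.span_span by blast
  moreover have "card (S \<union> T) \<le> k + l"
    using card_Un_le[of S T] S T by linarith
  ultimately show ?thesis
    unfolding codim_le_def using S T by (meson finite_UnI)
qed

text \<open>The span of \<open>a\<close> and \<open>b\<close> consists of 0, \<open>a\<close>,
  \<open>b\<close> and \<open>a + b\<close>, so four translations are to be tried. Taking
  \<open>b = 0\<close> covers a single translation.\<close>

lemma codim_leI2:
  assumes "\<And>v. v \<in> V \<Longrightarrow> v \<in> Z \<or> v + a \<in> Z \<or> v + b \<in> Z \<or> v + a + b \<in> Z"
  shows "codim_le Z V 2"
proof -
  have "V \<subseteq> F2.span (Z \<union> {a, b})"
  proof
    fix v assume "v \<in> V"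
    from assms[OF this] show "v \<in> F2.span (Z \<union> {a, b})"
      by (auto simp: span_insert_iff ac_simps intro: F2.span_base)
  qed
  then show ?thesis
    unfolding codim_le_def by (intro exI[of _ "{a, b}"]) (auto simp: card_insert_if)
qed

text \<open>Exchange, twice: a basis of \<open>Z\<close> is independent in the span of the
  \<open>n\<close> unit vectors, and these are independent in the span of that basis together with
  \<open>S\<close>.\<close>

lemma codim_le_dim:
  assumes "F2.subspace Z" "Z \<subseteq> coord_space n" "codim_le Z (coord_space n) k"
  shows "F2.dim Z \<le> n \<and> n \<le> F2.dim Z + k"
proof -
  let ?U = "unit_vector ` {..<n}"
  obtain S where S: "finite S" "card S \<le> k" "coord_space n \<subseteq> F2.span (Z \<union> S)"
    using assms(3) unfolding codim_le_def by blast
  obtain B where B: "B \<subseteq> Z" "F2.independent B" "Z \<subseteq> F2.span B" "card B = F2.dim Z"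
    using F2.basis_exists by blast
  have "B \<subseteq> F2.span ?U"
    using B(1) assms(2) coord_space_basis by blast
  then have fin: "finite B" and le: "card B \<le> n"
    using F2.independent_span_bound[of ?U B] B(2) coord_space_basis[of n] by auto
  have "Z \<union> S \<subseteq> F2.span (B \<union> S)"
    using B(3) F2.span_mono[of B "B \<union> S"] F2.span_superset[of "B \<union> S"] by blast
  then have "?U \<subseteq> F2.span (B \<union> S)"
    using S(3) coord_space_basis[of n] F2.span_superset[of ?U] F2.span_minimal[OF _ F2.subspace_span]
    by blast
  then have "card ?U \<le> card (B \<union> S)"
    using F2.independent_span_bound[of "B \<union> S" ?U] coord_space_basis[of n] fin S(1) by blast
  then show ?thesis
    using card_Un_le[of B S] S(2) B(4) le coord_space_basis[of n] by linarith
qed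

section \<open>Quadratic functions and their zeros\<close>

definition polar :: "((nat \<Rightarrow> bit) \<Rightarrow> bit) \<Rightarrow> (nat \<Rightarrow> bit) \<Rightarrow> (nat \<Rightarrow> bit) \<Rightarrow> bit" where
  "polar f x y = f (x + y) + f x + f y"

text \<open>This amounts to bilinearity of \<open>polar f\<close>: it is symmetric, and with scalars
  0 and 1 additivity is linearity.\<close>

definition quadratic_on :: "(nat \<Rightarrow> bit) set \<Rightarrow> ((nat \<Rightarrow> bit) \<Rightarrow> bit) \<Rightarrow> bool" where
  "quadratic_on V f \<longleftrightarrow> f 0 = 0 \<and>
     (\<forall>a\<in>V. \<forall>b\<in>V. \<forall>c\<in>V. polar f (a + b) c = polar f a c + polar f b c)"

lemma quadratic_on_subset: "quadratic_on V f \<Longrightarrow> W \<subseteq> V \<Longrightarrow> quadratic_on W f"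
  unfolding quadratic_on_def by blast

lemma polar_commute: "polar f x y = polar f y x"
  by (simp add: polar_def ac_simps)

lemma polar_self: "f 0 = 0 \<Longrightarrow> polar f x x = 0"
  by (simp add: polar_def ac_simps)

lemma polar_expand: "f (x + y) = f x + f y + polar f x y"
  by (simp add: polar_def ac_simps)

text \<open>By \<open>polar_expand\<close>, orthogonal zeros add up to a zero. The codimension bound
  depends on whether some \<open>a\<close>, \<open>b\<close> and \<open>a + b\<close> all have value
  1.\<close>

lemma quadratic_zeros:
  assumes V: "F2.subspace V" and q: "quadratic_on V f"
    and orth: "\<And>x y. x \<in> V \<Longrightarrow> y \<in> V \<Longrightarrow> f x = 0 \<Longrightarrow> f y = 0 \<Longrightarrow> polar f x y = 0"
  defines "Z \<equiv> {x\<in>V. f x = 0}"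
  shows "F2.subspace Z" "codim_le Z V 2"
proof -
  have f0: "f 0 = 0" using q by (simp add: quadratic_on_def)
  have V0: "0 \<in> V" and Vadd: "\<And>x y. x \<in> V \<Longrightarrow> y \<in> V \<Longrightarrow> x + y \<in> V"
    using V by (auto simp: subspace_iff)
  show "F2.subspace Z"
    unfolding subspace_iff
  proof (intro conjI ballI)
    show "0 \<in> Z"
      using f0 V0 by (simp add: Z_def)
    fix x y assume "x \<in> Z" "y \<in> Z"
    then show "x + y \<in> Z"
      using orth[of x y] Vadd polar_expand[of f x y] by (simp add: Z_def)
  qed
  show "codim_le Z V 2"
  proof (cases "\<exists>a\<in>V. \<exists>b\<in>V. f a = 1 \<and> f b = 1 \<and> f (a + b) = 1")
    case True
    then obtain a b where ab: "a \<in> V" "b \<in> V" "f a = 1" "f b = 1" "f (a + b) = 1"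
      by blast
    \<comment> \<open>\<open>f\<close> sums to zero over the seven nonzero vectors of \<open>span {a, b, v}\<close>, so it is not 1 on all of them.\<close>
    show ?thesis
    proof (rule codim_leI2[where a = a and b = b])
      fix v assume v: "v \<in> V"
      have "polar f (a + b) v = polar f a v + polar f b v"
        using q ab v by (simp add: quadratic_on_def)
      then have "f (v + a + b) + f (a + b) + f v = f (v + a) + f a + f v + (f (v + b) + f b + f v)"
        by (simp add: polar_def ac_simps)
      then have "f v = 0 \<or> f (v + a) = 0 \<or> f (v + b) = 0 \<or> f (v + a + b) = 0"
        using ab(3-5)
        by (cases "f v"; cases "f (v + a)"; cases "f (v + b)"; cases "f (v + a + b)"; simp)
      then show "v \<in> Z \<or> v + a \<in> Z \<or> v + b \<in> Z \<or> v + a + b \<in> Z"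
        using v ab Vadd by (auto simp: Z_def)
    qed
  next
    case False
    \<comment> \<open>Two vectors of value 1 now have a sum of value 0, so translating by one such
      vector suffices. If \<open>f\<close> vanishes on \<open>V\<close>, any \<open>a\<close> in
      \<open>V\<close> serves.\<close>
    obtain a where a: "a \<in> V" "f a = 1 \<or> (\<forall>x\<in>V. f x = 0)"
      using V0 by (metis bit_not_zero_iff)
    show ?thesis
    proof (rule codim_leI2[where a = a and b = 0])
      fix v assume v: "v \<in> V"
      then have "f v = 0 \<or> f (v + a) = 0"
        using False a by (metis bit_not_zero_iff bit_not_one_iff)
      then show "v \<in> Z \<or> v + a \<in> Z \<or> v + 0 \<in> Z \<or> v + a + 0 \<in> Z"
        using v a Vadd by (auto simp: Z_def)
    qed
  qed
qed

section \<open>Isometric embeddings and hyperbolic planes\<close>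

text \<open>Injectivity appears as a trivial kernel; additivity makes \<phi> linear over the
  two-element field.\<close>

definition embeds :: "nat \<Rightarrow> ((nat \<Rightarrow> bit) \<Rightarrow> bit) \<Rightarrow> (nat \<Rightarrow> bit) set \<Rightarrow>
    ((nat \<Rightarrow> bit) \<Rightarrow> bit) \<Rightarrow> bool" where
  "embeds m g V f \<longleftrightarrow> (\<exists>\<phi>.
     (\<forall>x\<in>coord_space m. \<phi> x \<in> V \<and> f (\<phi> x) = g x \<and> (\<phi> x = 0 \<longrightarrow> x = 0)) \<and>
     (\<forall>x\<in>coord_space m. \<forall>y\<in>coord_space m. \<phi> (x + y) = \<phi> x + \<phi> y))"


text \<open>Adding \<open>h\<close> flips the pairing with \<open>e\<close> and keeps the one with
  \<open>h\<close>; adding \<open>e\<close> does the reverse. So one of the four translates of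
  \<open>v\<close> is orthogonal to both.\<close>

lemma hyperbolic_split:
  assumes V: "F2.subspace V" and q: "quadratic_on V f"
    and eh: "e \<in> V" "h \<in> V" "polar f e h = 1"
  defines "W \<equiv> {v\<in>V. polar f v e = 0 \<and> polar f v h = 0}"
  shows "F2.subspace W" "codim_le W V 2"
proof -
  have f0: "f 0 = 0" and lin: "\<And>x y z. x \<in> V \<Longrightarrow> y \<in> V \<Longrightarrow> z \<in> V \<Longrightarrow>
      polar f (x + y) z = polar f x z + polar f y z"
    using q by (auto simp: quadratic_on_def)
  have V0: "0 \<in> V" and Vadd: "\<And>x y. x \<in> V \<Longrightarrow> y \<in> V \<Longrightarrow> x + y \<in> V"
    using V by (auto simp: subspace_iff)
  have polar0: "polar f 0 x = 0" for x
    using f0 by (simp add: polar_def)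
  show "F2.subspace W"
    using V0 Vadd eh by (auto simp: W_def subspace_iff lin polar0)
  have he: "polar f h e = 1"
    using eh(3) by (simp add: polar_commute)
  show "codim_le W V 2"
  proof (rule codim_leI2[where a = e and b = h])
    fix v assume v: "v \<in> V"
    show "v \<in> W \<or> v + e \<in> W \<or> v + h \<in> W \<or> v + e + h \<in> W"
      using v eh he Vadd
      by (cases "polar f v e"; cases "polar f v h") (simp_all add: W_def lin polar_self f0)
  qed
qed

text \<open>The pairings with \<open>e\<close> and \<open>h\<close> recover the coefficients, which
  later yields injectivity.\<close>

lemma hyperbolic_plane_values:
  assumes "f 0 = 0" "f e = 0" "f h = 0" "polar f e h = 1"
  shows "f (smul s e + smul r h) = s * r"
    and "polar f (smul s e + smul r h) e = r"
    and "polar f (smul s e + smul r h) h = s"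
proof -
  have 1: "f (e + h) = 1"
    using assms by (simp add: polar_def)
  have 2: "e + h + e = h" "e + h + h = e"
    by (simp_all add: ac_simps)
  show "f (smul s e + smul r h) = s * r"
    using assms 1 by (cases s; cases r) simp_all
  show "polar f (smul s e + smul r h) e = r"
    using assms 1 by (cases s; cases r) (simp_all add: polar_def 2 ac_simps)
  show "polar f (smul s e + smul r h) h = s"
    using assms 1 by (cases s; cases r) (simp_all add: polar_def 2 ac_simps)
qed

text \<open>Since the plane is orthogonal to the image of the given embedding, values of
  \<open>f\<close> add up across the two parts, and the plane component can be chosen to realise
  \<open>g\<close> on one more basis vector.\<close>

lemma embeds_Suc:
  assumes V: "F2.subspace V" and q: "quadratic_on V f"
    and qg: "quadratic_on (coord_space (Suc m)) g"
    and eh: "e \<in> V" "h \<in> V" "f e = 0" "f h = 0" "polar f e h = 1"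
    and emb: "embeds m g {v\<in>V. polar f v e = 0 \<and> polar f v h = 0} f"
  shows "embeds (Suc m) g V f"
proof -
  define W where "W = {v\<in>V. polar f v e = 0 \<and> polar f v h = 0}"
  obtain \<phi> where \<phi>: "\<And>x. x \<in> coord_space m \<Longrightarrow> \<phi> x \<in> W"
      "\<And>x. x \<in> coord_space m \<Longrightarrow> f (\<phi> x) = g x"
      "\<And>x. x \<in> coord_space m \<Longrightarrow> \<phi> x = 0 \<Longrightarrow> x = 0"
    and \<phi>_add: "\<And>x y. x \<in> coord_space m \<Longrightarrow> y \<in> coord_space m \<Longrightarrow> \<phi> (x + y) = \<phi> x + \<phi> y"
    using emb unfolding embeds_def W_def by blast
  have f0: "f 0 = 0" and lin: "\<And>x y z. x \<in> V \<Longrightarrow> y \<in> V \<Longrightarrow> z \<in> V \<Longrightarrow>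
      polar f (x + y) z = polar f x z + polar f y z"
    using q by (auto simp: quadratic_on_def)
  have Vadd: "\<And>x y. x \<in> V \<Longrightarrow> y \<in> V \<Longrightarrow> x + y \<in> V"
    and Vsmul: "\<And>c x. x \<in> V \<Longrightarrow> smul c x \<in> V"
    using V by (auto simp: F2.subspace_def)
  note plane = hyperbolic_plane_values[of f e h, OF f0 eh(3-5)]
  have orth: "polar f w (smul s e + smul r h) = 0" if "w \<in> W" for w s r
  proof -
    have w: "w \<in> V" "polar f e w = 0" "polar f h w = 0"
      using that by (simp_all add: W_def polar_commute)
    have "polar f (smul s e + smul r h) w = polar f (smul s e) w + polar f (smul r h) w"
      using lin Vsmul eh w by blast
    moreover have "polar f (smul s e) w = 0" "polar f (smul r h) w = 0"
      using w f0 by (cases s; cases r; simp add: polar_def)+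
    ultimately show ?thesis
      by (simp add: polar_commute)
  qed
  define u where "u = unit_vector m"
  \<comment> \<open>The image \<open>e + g(u) h\<close> of \<open>u\<close> gives the value \<open>g u\<close> at \<open>u\<close>; adding \<open>polar g y u\<close> times \<open>h\<close> to the
    image of \<open>y\<close> corrects its pairing with \<open>u\<close> and leaves the value at \<open>y\<close> unchanged.\<close>
  define r where "r y t = t * g u + polar g y u" for y and t :: bit
  define \<psi> where "\<psi> y t = \<phi> y + (smul t e + smul (r y t) h)" for y t
  have um: "u m = 1"
    by (simp add: u_def unit_vector_def)
  have u: "u \<in> coord_space (Suc m)"
    by (simp add: u_def unit_vector_in)
  have sub: "y \<in> coord_space (Suc m)" if "y \<in> coord_space m" for y
    using that coord_space_mono[of m "Suc m"] by auto
  have \<psi>V: "\<psi> y t \<in> V" if "y \<in> coord_space m" for y t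
    using \<phi>(1)[OF that] Vadd Vsmul eh by (simp add: \<psi>_def W_def)
  have \<psi>f: "f (\<psi> y t) = g (y + smul t u)" if y: "y \<in> coord_space m" for y t
  proof -
    have "f (\<psi> y t) = g y + t * r y t"
      unfolding \<psi>_def using \<phi>[OF y] by (simp add: polar_expand[of f "\<phi> y"] plane orth)
    also have "\<dots> = g (y + smul t u)"
      using polar_expand[of g y u] by (cases t) (simp_all add: r_def ac_simps)
    finally show ?thesis .
  qed
  have \<psi>0: "y = 0 \<and> t = 0" if y: "y \<in> coord_space m" and "\<psi> y t = 0" for y t
  proof -
    have eq: "\<phi> y = smul t e + smul (r y t) h"
      using that by (simp add: \<psi>_def)
    have "polar f (\<phi> y) e = 0" "polar f (\<phi> y) h = 0"
      using \<phi>(1)[OF y] by (simp_all add: W_def)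
    then have "t = 0" "r y t = 0"
      unfolding eq plane by simp_all
    then show ?thesis
      using eq \<phi>(3)[OF y] by simp
  qed
  have \<psi>_add: "\<psi> (y + y') (t + t') = \<psi> y t + \<psi> y' t'"
    if y: "y \<in> coord_space m" "y' \<in> coord_space m" for y y' t t'
  proof -
    \<comment> \<open>Here \<open>g\<close> must be quadratic on \<open>coord_space (Suc m)\<close>,
      as \<open>u\<close> lies outside \<open>coord_space m\<close>.\<close>
    have "polar g (y + y') u = polar g y u + polar g y' u"
      using qg u y sub by (simp add: quadratic_on_def)
    then have "r (y + y') (t + t') = r y t + r y' t'"
      by (simp add: r_def algebra_simps)
    then show ?thesis
      using \<phi>_add[OF y] by (simp add: \<psi>_def F2.scale_left_distrib ac_simps)
  qed
  \<comment> \<open>Clearing coordinate \<open>m\<close> splits \<open>x\<close> into the two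
    arguments of \<psi>.\<close>
  define low where "low x = x + smul (x m) u" for x
  have low: "low x \<in> coord_space m" "x = low x + smul (x m) u" if "x \<in> coord_space (Suc m)" for x
    using coord_space_Suc_cases[OF that] by (auto simp: low_def u_def ac_simps)
  have low_add: "low (x + y) = low x + low y" for x y
    by (simp add: low_def F2.scale_left_distrib ac_simps)
  show ?thesis
    unfolding embeds_def
  proof (intro exI[of _ "\<lambda>x. \<psi> (low x) (x m)"] conjI ballI impI)
    fix x assume x: "x \<in> coord_space (Suc m)"
    show "\<psi> (low x) (x m) \<in> V"
      using \<psi>V low x by blast
    show "f (\<psi> (low x) (x m)) = g x"
      using \<psi>f[OF low(1)[OF x]] low(2)[OF x] by metis
    show "x = 0" if "\<psi> (low x) (x m) = 0"
      using \<psi>0[OF low(1)[OF x] that] low(2)[OF x] by simp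
    fix y assume y: "y \<in> coord_space (Suc m)"
    show "\<psi> (low (x + y)) ((x + y) m) = \<psi> (low x) (x m) + \<psi> (low y) (y m)"
      using \<psi>_add[OF low(1)[OF x] low(1)[OF y]] by (simp add: low_add)
  qed
qed

text \<open>Induction on \<open>m\<close> with \<open>V\<close> general, as each step passes to an
  orthogonal complement of codimension at most 2. If no hyperbolic pair is left, the zeros cost a
  final 2, which the current step still has available.\<close>

lemma embeds_or_large_zero_subspace:
  assumes "F2.subspace V" "quadratic_on V f" "quadratic_on (coord_space m) g"
  shows "embeds m g V f \<or>
    (\<exists>Z\<subseteq>V. F2.subspace Z \<and> (\<forall>z\<in>Z. f z = 0) \<and> codim_le Z V (2 * m))"
  using assms
proof (induction m arbitrary: V)
  case 0
  then have "embeds 0 g V f"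
    unfolding embeds_def
    by (intro exI[of _ "\<lambda>x. x"]) (auto simp: coord_space_0 subspace_iff quadratic_on_def)
  then show ?case ..
next
  case (Suc m)
  show ?case
  proof (cases "\<exists>e\<in>V. \<exists>h\<in>V. f e = 0 \<and> f h = 0 \<and> polar f e h = 1")
    case True
    then obtain e h where eh: "e \<in> V" "h \<in> V" "f e = 0" "f h = 0" "polar f e h = 1"
      by blast
    define W where "W = {v\<in>V. polar f v e = 0 \<and> polar f v h = 0}"
    have W: "F2.subspace W" "codim_le W V 2" "W \<subseteq> V"
      using hyperbolic_split[OF Suc.prems(1,2) eh(1,2,5)] by (auto simp: W_def)
    have "quadratic_on W f" "quadratic_on (coord_space m) g"
      using Suc.prems quadratic_on_subset W(3) coord_space_mono[of m "Suc m"] by auto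
    from Suc.IH[OF W(1) this] show ?thesis
    proof
      assume "embeds m g W f"
      then show ?thesis
        using embeds_Suc[OF Suc.prems eh] by (simp add: W_def)
    next
      assume "\<exists>Z\<subseteq>W. F2.subspace Z \<and> (\<forall>z\<in>Z. f z = 0) \<and> codim_le Z W (2 * m)"
      then obtain Z where Z: "Z \<subseteq> W" "F2.subspace Z" "\<forall>z\<in>Z. f z = 0" "codim_le Z W (2 * m)"
        by blast
      have "codim_le Z V (2 * Suc m)"
        using codim_le_trans[OF Z(4) W(2)] by simp
      then show ?thesis
        using Z W(3) by blast
    qed
  next
    case False
    then have orth: "polar f x y = 0" if "x \<in> V" "y \<in> V" "f x = 0" "f y = 0" for x y
      using that by (metis bit_not_zero_iff)
    have "codim_le {x\<in>V. f x = 0} V (2 * Suc m)"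
      by (rule codim_le_mono[OF quadratic_zeros(2)[OF Suc.prems(1,2) orth]]) auto
    moreover have "F2.subspace {x\<in>V. f x = 0}"
      by (rule quadratic_zeros(1)[OF Suc.prems(1,2) orth])
    ultimately show ?thesis
      by (intro disjI2 exI[of _ "{x\<in>V. f x = 0}"]) simp
  qed
qed

section \<open>From matroids to quadratic functions and back\<close>

definition char_fun :: "matroid \<Rightarrow> (nat \<Rightarrow> bit) \<Rightarrow> bit" where
  "char_fun M x = of_bool (x \<in> elements M)"

text \<open>Additivity of the polar form rearranges to a zero sum over the seven nonzero
  combinations of \<open>a\<close>, \<open>b\<close>, \<open>c\<close>. For independent triples
  these form a flat.\<close>

lemma quadratic_on_char_fun:
  assumes M: "M \<in> \<E>\<^sub>3"
  shows "quadratic_on (coord_space (dimension M)) (char_fun M)"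
  unfolding quadratic_on_def
proof (intro conjI ballI)
  let ?f = "char_fun M" and ?V = "coord_space (dimension M)"
  have "0 \<notin> elements M"
    using M by (auto simp: \<E>\<^sub>3_def simple_binary_matroid_def ground_def)
  then show f0: "?f 0 = 0"
    by (simp add: char_fun_def)
  fix a b c assume abc: "a \<in> ?V" "b \<in> ?V" "c \<in> ?V"
  have "?f a + ?f b + ?f c + ?f (a + b) + ?f (a + c) + ?f (b + c) + ?f (a + b + c) = 0"
  \<comment> \<open>These are exactly the dependent triples; their terms cancel in pairs, up to the
    value at 0.\<close>
  proof (cases "a = 0 \<or> b = 0 \<or> c = 0 \<or> a = b \<or> a = c \<or> b = c \<or> a + b = c")
    case True
    then show ?thesis
      using f0 by (elim disjE) (auto simp: ac_simps)
  next
    case False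
    let ?B = "{a, b, c}"
    let ?F = "{a, b, c, a + b, a + c, b + c, a + b + c}"
    have solve: "v + w = z \<longleftrightarrow> v = z + w" for v w z :: "nat \<Rightarrow> bit"
      by (metis add.commute vec_add_self_left)
    have neq: "a \<noteq> 0" "b \<noteq> 0" "c \<noteq> 0" "a \<noteq> b" "a \<noteq> c" "b \<noteq> c" "a + b \<noteq> c"
      using False by auto
    have sum_neq: "a \<noteq> b + c" "b \<noteq> a + c"
      using neq(7) by (metis add.commute vec_add_self_left)+
    have "x \<in> F2.span ?B \<longleftrightarrow> x = 0 \<or> x \<in> ?F" for x
      by (auto simp: span_insert_iff solve ac_simps)
    then have span: "F2.span ?B - {0} = ?F"
      using neq by auto
    have ind: "F2.independent ?B"
      using neq sum_neq
      by (simp add: F2.independent_insert F2.independent_empty span_insert_iff)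
    have "F2.dim (F2.span ?B) = 3"
      using neq by (subst F2.dim_span_eq_card_independent[OF ind]) simp
    moreover have "F2.span ?B \<subseteq> ?V"
      using abc subspace_coord_space by (intro F2.span_minimal) auto
    ultimately have "is_flat M 3 ?F"
      unfolding is_flat_def using span by (metis F2.subspace_span)
    then have "even (card (elements M \<inter> ?F))"
      using M unfolding \<E>\<^sub>3_def by blast
    \<comment> \<open>Reducing the cardinality modulo 2 turns parity into a sum of bits.\<close>
    then have "(of_nat (card (elements M \<inter> ?F)) :: bit) = 0"
      by (elim evenE) simp
    also have "of_nat (card (elements M \<inter> ?F)) = (\<Sum>x\<in>?F. ?f x)"
      by (simp only: char_fun_def) (simp add: sum_of_bool_eq Int_commute Collect_conj_eq)
    also have "\<dots> = ?f a + ?f b + ?f c + ?f (a + b) + ?f (a + c) + ?f (b + c) + ?f (a + b + c)"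
      using neq sum_neq sum_neq[symmetric] by (simp add: ac_simps)
    finally show ?thesis .
  qed
  then show "polar ?f (a + b) c = polar ?f a c + polar ?f b c"
    unfolding polar_def
    by (cases "?f a"; cases "?f b"; cases "?f c"; cases "?f (a + b)"; cases "?f (a + c)";
        cases "?f (b + c)"; cases "?f (a + b + c)"; simp)
qed

lemma induced_restriction_if_embeds:
  assumes N: "simple_binary_matroid N"
    and emb: "embeds (dimension N) (char_fun N) (coord_space (dimension M)) (char_fun M)"
  shows "induced_restriction N M"
proof -
  let ?W = "coord_space (dimension N)"
  obtain \<phi> where \<phi>: "\<And>x. x \<in> ?W \<Longrightarrow> \<phi> x \<in> coord_space (dimension M)"
      "\<And>x. x \<in> ?W \<Longrightarrow> char_fun M (\<phi> x) = char_fun N x"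
      "\<And>x. x \<in> ?W \<Longrightarrow> \<phi> x = 0 \<Longrightarrow> x = 0"
    and add: "\<And>x y. x \<in> ?W \<Longrightarrow> y \<in> ?W \<Longrightarrow> \<phi> (x + y) = \<phi> x + \<phi> y"
    using emb unfolding embeds_def by blast
  have W: "0 \<in> ?W" "\<And>x y. x \<in> ?W \<Longrightarrow> y \<in> ?W \<Longrightarrow> x + y \<in> ?W"
    using subspace_coord_space by (auto simp: subspace_iff)
  have "\<phi> 0 = 0"
    using add[OF W(1) W(1)] by simp
  then have "\<phi> (smul c x) = smul c (\<phi> x)" for c x
    by (cases c) simp_all
  then have "linear_between (dimension N) (dimension M) \<phi>"
    using \<phi> add by (auto simp: linear_between_def)
  moreover have "inj_on \<phi> ?W"
  proof (rule inj_onI)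
    fix x y assume xy: "x \<in> ?W" "y \<in> ?W" "\<phi> x = \<phi> y"
    then have "\<phi> (x + y) = 0"
      by (simp add: add)
    then show "x = y"
      using \<phi>(3) W(2) xy by (metis vec_add_eq_0_iff)
  qed
  moreover have "\<phi> ` elements N = elements M \<inter> \<phi> ` ground N"
  proof -
    have "x \<in> elements N \<longleftrightarrow> \<phi> x \<in> elements M" if "x \<in> ?W" for x
      using \<phi>(2)[OF that] by (simp add: char_fun_def of_bool_def split: if_splits)
    then show ?thesis
      using N by (auto simp: simple_binary_matroid_def ground_def)
  qed
  ultimately show ?thesis
    unfolding induced_restriction_def by blast
qed

lemma critical_number_le:
  assumes Z: "F2.subspace Z" "Z \<subseteq> coord_space (dimension M)" "\<forall>z\<in>Z. char_fun M z = 0"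
    and cod: "codim_le Z (coord_space (dimension M)) k"
  shows "critical_number M \<le> k"
proof -
  let ?n = "dimension M"
  have dim: "F2.dim Z \<le> ?n" "?n \<le> F2.dim Z + k"
    using codim_le_dim[OF Z(1,2) cod] by auto
  \<comment> \<open>The witness is the exact codimension of \<open>Z\<close>, since \<open>k\<close>
    may exceed the dimension. The truncated subtraction returns \<open>F2.dim Z\<close> because
    \<open>F2.dim Z \<le> ?n\<close>.\<close>
  have "is_flat M (?n - (?n - F2.dim Z)) (Z - {0})"
    using Z dim by (auto simp: is_flat_def)
  moreover have "Z - {0} \<subseteq> ground M - elements M"
    using Z by (auto simp: ground_def char_fun_def)
  ultimately have "critical_number M \<le> ?n - F2.dim Z"
    unfolding critical_number_def by (intro Least_le) auto
  then show ?thesis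
    using dim by linarith
qed

theorem theorem1p7:
  fixes \<M> :: "matroid set"
  assumes "\<M> \<subset> \<E>\<^sub>3"
    and "closed_under_induced_restrictions \<M>"
  shows "\<exists>k. \<forall>M\<in>\<M>. critical_number M \<le> k"
proof -
  \<comment> \<open>A single excluded \<open>N\<close> fixes the bound for the whole class.\<close>
  obtain N where N: "N \<in> \<E>\<^sub>3" "N \<notin> \<M>"
    using assms(1) by blast
  then have sN: "simple_binary_matroid N"
    by (simp add: \<E>\<^sub>3_def)
  have "critical_number M \<le> 2 * dimension N" if M: "M \<in> \<M>" for M
  proof -
    have "\<not> induced_restriction N M"
      using assms(2) M N sN unfolding closed_under_induced_restrictions_def by blast
    then have "\<not> embeds (dimension N) (char_fun N) (coord_space (dimension M)) (char_fun M)"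
      using induced_restriction_if_embeds sN by blast
    moreover have "M \<in> \<E>\<^sub>3"
      using M assms(1) by blast
    ultimately obtain Z where "Z \<subseteq> coord_space (dimension M)" "F2.subspace Z"
        "\<forall>z\<in>Z. char_fun M z = 0" "codim_le Z (coord_space (dimension M)) (2 * dimension N)"
      using embeds_or_large_zero_subspace[OF subspace_coord_space
          quadratic_on_char_fun[OF \<open>M \<in> \<E>\<^sub>3\<close>] quadratic_on_char_fun[OF N(1)]]
      by blast
    then show ?thesis
      by (intro critical_number_le)
  qed
  then show ?thesis
    by blast
qed

end
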